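(* For every integer $n\geq 3$, $$sn(W_n\circ K_1)=\begin{cases}n+1, & \text{if } n \text{ is even},\\ n+3, & \text{if } n \text{ is odd}.\end{cases}$$
   Context: All graphs are finite, undirected, simple and connected. $\chi(G)$ is the chromatic number. The wheel $W_n$ has order $n+1$ and is obtained from the cycle $C_n=v_1v_2\dots v_nv_1$ by adding a new vertex $v$ joined to every vertex of $C_n$. Sudoku number: let $\chi(G)=k$ and fix the set of $k$ colors $\{1,\dots,k\}$. For $S\subset V(G)$ let $C_0$ be a proper coloring of the induced subgraph $G[S]$ with colors from these $k$ colors (at most $k$ colors are used). $C_0$ is called extendable if it can be extended to a proper coloring of $G$ with these $k$ colors, and it is a Sudoku coloring of $G$ if this extension exists and is unique. The Sudoku number $sn(G)$ is the smallest $|S|$ such that $G[S]$ admits a Sudoku coloring. Corona product: $G\circ H$ is obtained from one copy of $G$ and $|V(G)|$ disjoint copies of $H$ by joining the $i$-th vertex of $G$ to every vertex of the $i$-th copy of $H$. *)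

theory Defs
  imports "Graph_Theory.Graph_Theory" "HOL-Library.FuncSet"
begin

text \<open>
  Finite simple undirected graphs are represented as in the entry Graph_Theory, i.e. as finite
  loop-free symmetric digraphs without parallel arcs (\<^locale>\<open>pair_graph\<close>): an undirected
  edge \<open>uv\<close> is the pair of arcs \<open>(u, v)\<close>, \<open>(v, u)\<close>.
\<close>

section \<open>Colorings and the Sudoku number\<close>

text \<open>
  Colorings are extensional (undefined outside the vertex set), so that two colorings
  are equal iff they agree on all vertices. Not all \<open>k\<close> colors need be used.
\<close>

definition proper_coloring :: "('a, 'b) pre_digraph \<Rightarrow> nat \<Rightarrow> ('a \<Rightarrow> nat) \<Rightarrow> bool" where
  "proper_coloring G k c \<longleftrightarrow>
     c \<in> verts G \<rightarrow>\<^sub>E {1..k} \<and> (\<forall>e \<in> arcs G. c (tail G e) \<noteq> c (head G e))"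

definition chromatic_number :: "('a, 'b) pre_digraph \<Rightarrow> nat" where
  "chromatic_number G = (LEAST k. \<exists>c. proper_coloring G k c)"

definition extends_coloring ::
    "('a, 'b) pre_digraph \<Rightarrow> 'a set \<Rightarrow> ('a \<Rightarrow> nat) \<Rightarrow> ('a \<Rightarrow> nat) \<Rightarrow> bool" where
  "extends_coloring G S C0 c \<longleftrightarrow>
     proper_coloring G (chromatic_number G) c \<and> (\<forall>v \<in> S. c v = C0 v)"

definition sudoku_coloring :: "('a, 'b) pre_digraph \<Rightarrow> 'a set \<Rightarrow> ('a \<Rightarrow> nat) \<Rightarrow> bool" where
  "sudoku_coloring G S C0 \<longleftrightarrow>
     S \<subseteq> verts G \<and> proper_coloring (G \<restriction> S) (chromatic_number G) C0 \<and>
     (\<exists>!c. extends_coloring G S C0 c)"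

definition sudoku_number :: "('a, 'b) pre_digraph \<Rightarrow> nat" where
  "sudoku_number G = (LEAST m. \<exists>S C0. card S = m \<and> sudoku_coloring G S C0)"


section \<open>Graph constructions\<close>

definition complete_graph :: "nat \<Rightarrow> nat pair_pre_digraph" where
  "complete_graph n =
     \<lparr> pverts = {1..n}, parcs = {(i, j). i \<in> {1..n} \<and> j \<in> {1..n} \<and> i \<noteq> j} \<rparr>"

text \<open>Vertex \<open>i\<close> stands for \<open>v\<^sub>i\<close>; this is a cycle only for \<open>n \<ge> 3\<close>.\<close>

definition cycle_graph :: "nat \<Rightarrow> nat pair_pre_digraph" where
  "cycle_graph n =
     (let A = {(i, i + 1) |i. 1 \<le> i \<and> i < n} \<union> {(n, 1)}
      in \<lparr> pverts = {1..n}, parcs = A \<union> A\<inverse> \<rparr>)"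

text \<open>The hub of the wheel is \<open>None\<close>, its rim is the image of the cycle under \<open>Some\<close>.\<close>

definition wheel_graph :: "nat \<Rightarrow> nat option pair_pre_digraph" where
  "wheel_graph n =
     \<lparr> pverts = insert None (Some ` pverts (cycle_graph n)),
       parcs = {(Some u, Some v) |u v. (u, v) \<in> parcs (cycle_graph n)}
             \<union> {(None, Some v) |v. v \<in> pverts (cycle_graph n)}
             \<union> {(Some v, None) |v. v \<in> pverts (cycle_graph n)} \<rparr>"

text \<open>
  \<open>Inl g\<close> is the vertex \<open>g\<close> of the copy of \<open>G\<close>; \<open>Inr (g, h)\<close> is the vertex \<open>h\<close> of the copy
  of \<open>H\<close> belonging to \<open>g\<close>.
\<close>

definition corona ::
    "'a pair_pre_digraph \<Rightarrow> 'b pair_pre_digraph \<Rightarrow> ('a + 'a \<times> 'b) pair_pre_digraph" where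
  "corona G H =
     \<lparr> pverts = Inl ` pverts G \<union> Inr ` (pverts G \<times> pverts H),
       parcs = {(Inl u, Inl v) |u v. (u, v) \<in> parcs G}
             \<union> {(Inr (g, x), Inr (g, y)) |g x y. g \<in> pverts G \<and> (x, y) \<in> parcs H}
             \<union> {(Inl g, Inr (g, h)) |g h. g \<in> pverts G \<and> h \<in> pverts H}
             \<union> {(Inr (g, h), Inl g) |g h. g \<in> pverts G \<and> h \<in> pverts H} \<rparr>"


section \<open>Basic properties of the definitions\<close>

lemma pair_graph_altI:
  assumes "finite (pverts G)" "parcs G \<subseteq> pverts G \<times> pverts G" "sym (parcs G)" "irrefl (parcs G)"
  shows "pair_graph G"
proof
  show "finite (parcs G)"
    using assms finite_subset by blast
next
  show "fst e \<noteq> snd e" if "e \<in> parcs G" for e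
    using assms(4) that by (cases e) (auto simp: irrefl_def)
qed (use assms in \<open>auto simp: symmetric_def\<close>)

lemma pair_graph_altD:
  assumes "pair_graph G"
  shows "finite (pverts G)" "parcs G \<subseteq> pverts G \<times> pverts G" "sym (parcs G)" "irrefl (parcs G)"
proof -
  interpret pair_graph G by fact
  show "finite (pverts G)" by simp
  show "parcs G \<subseteq> pverts G \<times> pverts G" using wellformed' by auto
  show "sym (parcs G)" using sym_arcs by (simp add: symmetric_def)
  show "irrefl (parcs G)" using no_loops unfolding irrefl_def by fastforce
qed

lemma complete_graph_K: "K\<^bsub>n\<^esub> (with_proj (complete_graph n))"
  by (auto simp: complete_digraph_pair_def complete_graph_def)

lemma pair_graph_complete_graph: "pair_graph (complete_graph n)"
  by (rule pair_graph_altI) (auto simp: complete_graph_def sym_def irrefl_def)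

lemma pair_graph_cycle_graph: "n \<ge> 3 \<Longrightarrow> pair_graph (cycle_graph n)"
  by (rule pair_graph_altI) (auto simp: cycle_graph_def Let_def sym_def irrefl_def)

lemma pair_graph_wheel_graph:
  assumes "n \<ge> 3"
  shows "pair_graph (wheel_graph n)"
  by (rule pair_graph_altI)
     (use pair_graph_altD[OF pair_graph_cycle_graph[OF assms]]
      in \<open>auto simp: wheel_graph_def sym_def irrefl_def\<close>)

lemma card_wheel_graph: "card (pverts (wheel_graph n)) = n + 1"
  by (auto simp: wheel_graph_def cycle_graph_def Let_def card_image)

lemma pair_graph_corona:
  assumes "pair_graph G" "pair_graph H"
  shows "pair_graph (corona G H)"
proof (rule pair_graph_altI)
  note GH = pair_graph_altD[OF assms(1)] pair_graph_altD[OF assms(2)]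
  show "irrefl (parcs (corona G H))"
    using GH(4,8) unfolding irrefl_def corona_def by force
qed (use pair_graph_altD[OF assms(1)] pair_graph_altD[OF assms(2)]
      in \<open>auto simp: corona_def sym_def\<close>)

lemma connected_wheel_corona:
  assumes "n \<ge> 3"
  shows "connected (with_proj (corona (wheel_graph n) (complete_graph 1)))"
proof -
  let ?G = "corona (wheel_graph n) (complete_graph 1)"
  let ?h = "Inl None :: nat option + nat option \<times> nat"
  interpret pair_graph ?G
    by (intro pair_graph_corona pair_graph_wheel_graph pair_graph_complete_graph assms)
  have arc: "u \<rightarrow>\<^sup>*\<^bsub>with_proj ?G\<^esub> v" if "(u, v) \<in> parcs ?G" for u v
    using that by (intro reachable_adjI) simp
  have hub: "Inl g \<rightarrow>\<^sup>*\<^bsub>with_proj ?G\<^esub> ?h" if "g \<in> pverts (wheel_graph n)" for g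
  proof (cases g)
    case None
    have "?h \<in> pverts ?G" by (simp add: corona_def wheel_graph_def)
    then show ?thesis unfolding None by (rule reachable_refl)
  next
    case (Some i)
    with that show ?thesis by (intro arc) (auto simp: corona_def wheel_graph_def)
  qed
  have to_hub: "u \<rightarrow>\<^sup>*\<^bsub>with_proj ?G\<^esub> ?h" if "u \<in> pverts ?G" for u
  proof (cases u)
    case (Inl g)
    with that hub show ?thesis by (auto simp: corona_def)
  next
    case (Inr p)
    obtain g x where p: "p = (g, x)" by (cases p)
    with that Inr have g: "g \<in> pverts (wheel_graph n)" and x: "x \<in> pverts (complete_graph 1)"
      by (auto simp: corona_def)
    have "u \<rightarrow>\<^sup>*\<^bsub>with_proj ?G\<^esub> Inl g"
      using g x Inr p by (intro arc) (auto simp: corona_def)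
    then show ?thesis using hub[OF g] by (rule reachable_trans)
  qed
  have "strongly_connected (with_proj ?G)"
  proof (rule strongly_connectedI)
    show "verts (with_proj ?G) \<noteq> {}" by (auto simp: corona_def wheel_graph_def)
    fix u v assume "u \<in> verts (with_proj ?G)" "v \<in> verts (with_proj ?G)"
    then have "u \<rightarrow>\<^sup>*\<^bsub>with_proj ?G\<^esub> ?h" "?h \<rightarrow>\<^sup>*\<^bsub>with_proj ?G\<^esub> v"
      using to_hub symmetric_reachable[OF sym_arcs] by auto
    then show "u \<rightarrow>\<^sup>*\<^bsub>with_proj ?G\<^esub> v" by (rule reachable_trans)
  qed
  then show ?thesis
    unfolding connected_def strongly_connected_def
    using reachable_mk_symmetricI by auto
qed

text \<open>Both minima are attained, so \<open>LEAST\<close> is used meaningfully on finite loop-free graphs.\<close>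

lemma chromatic_number_attained:
  assumes "pair_graph G"
  shows "\<exists>c. proper_coloring (with_proj G) (chromatic_number (with_proj G)) c"
proof -
  note G = pair_graph_altD[OF assms]
  obtain f where f: "bij_betw f (pverts G) {1..card (pverts G)}"
    using G(1) finite_same_card_bij[of "pverts G" "{1..card (pverts G)}"] by auto
  have "proper_coloring (with_proj G) (card (pverts G)) (restrict f (pverts G))"
    unfolding proper_coloring_def
  proof (intro conjI ballI)
    show "restrict f (pverts G) \<in> verts (with_proj G) \<rightarrow>\<^sub>E {1..card (pverts G)}"
      using f by (auto simp: bij_betw_def)
    fix e assume "e \<in> arcs (with_proj G)"
    then obtain u v where e: "e = (u, v)" "(u, v) \<in> parcs G" by (cases e) auto
    then have "u \<in> pverts G" "v \<in> pverts G" "u \<noteq> v"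
      using G(2,4) by (auto simp: irrefl_def)
    then show "restrict f (pverts G) (tail (with_proj G) e)
        \<noteq> restrict f (pverts G) (head (with_proj G) e)"
      using f e by (auto simp: bij_betw_def inj_on_def)
  qed
  then show ?thesis
    unfolding chromatic_number_def
    by (rule LeastI[where P = "\<lambda>k. \<exists>c. proper_coloring (with_proj G) k c", OF exI])
qed

lemma sudoku_number_attained:
  assumes "pair_graph G"
  shows "\<exists>S C0. card S = sudoku_number (with_proj G) \<and> sudoku_coloring (with_proj G) S C0"
proof -
  obtain c where c: "proper_coloring (with_proj G) (chromatic_number (with_proj G)) c"
    using chromatic_number_attained[OF assms] by blast
  have "c' = c" if "extends_coloring (with_proj G) (pverts G) c c'" for c'
    using that c unfolding extends_coloring_def proper_coloring_def
    by (intro ext) (metis PiE_arb with_proj_simps(1))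
  moreover have "extends_coloring (with_proj G) (pverts G) c c"
    using c by (simp add: extends_coloring_def)
  ultimately have "sudoku_coloring (with_proj G) (pverts G) c"
    using c unfolding sudoku_coloring_def by (auto simp: proper_coloring_def)
  then show ?thesis
    unfolding sudoku_number_def
    by (intro LeastI[where P = "\<lambda>m. \<exists>S C0. card S = m \<and> sudoku_coloring (with_proj G) S C0"])
       blast
qed

end

theory Submission
  imports Defs
begin

text \<open>
  There are always at least three colors, so a pendant vertex outside \<open>S\<close> could be recolored; hence
  \<open>S\<close> contains all \<open>n + 1\<close> pendant vertices, and each of them just forbids one color at its wheel
  vertex. For even \<open>n\<close> suitable pendant colors already force a unique coloring of the wheel.

  Let \<open>n\<close> be odd, so that there are four colors. Fix the color \<open>h\<close> of the hub and the color \<open>t\<close> of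
  one rim vertex. The proper colorings of the remaining path of \<open>n - 1\<close> rim vertices, counted with
  suitable nonzero weights, have a sum that depends neither on \<open>h\<close> nor on \<open>t\<close>, because \<open>n - 1\<close>
  is even. If the coloring is unique, the sum has a single nonzero term, so it is nonzero for all
  \<open>h\<close> and \<open>t\<close>: changing \<open>h\<close> alone or \<open>t\<close> alone to another allowed color still leaves an
  extendable coloring. Therefore fixing at most one wheel vertex never suffices.
\<close>

section \<open>Weighted sums over path colorings\<close>

text \<open>
  The factors \<open>(-1) ^ y * (3 choose (y - 1))\<close> are those of the third difference on \<open>{1..4}\<close>, which
  annihilates polynomials of degree at most 2; the factors \<open>y - f\<close> and \<open>y - h\<close> remove the two
  forbidden colors.
\<close>

fun path_sum :: "nat \<Rightarrow> nat \<Rightarrow> nat list \<Rightarrow> nat \<Rightarrow> int" where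
  "path_sum h t [] x = int x - int t"
| "path_sum h t (f # fs) x =
     (\<Sum>y\<in>{1..4}. (-1) ^ y * int (3 choose (y - 1)) * (int x - int y) * (int y - int f)
        * (int y - int h) * path_sum h t fs y)"

text \<open>The part of the closed form in \<open>path_sum_eq\<close> that depends on the forbidden
  colors \<open>fs\<close> alone.\<close>

fun path_const :: "nat list \<Rightarrow> int" where
  "path_const [] = 0"
| "path_const (f # fs) = int f - 10 - path_const fs"

lemma atLeastAtMost_1_4: "{1..4::nat} = {1, 2, 3, 4}"
  by auto

text \<open>Apart from the binomial weight and a power of 6, each summand is minus a monic quartic
  in \<open>y\<close>. The weighted sum of such a quartic is 6 times (10 - sum of its roots), where
  10 = 1+2+3+4. So each step flips the sign of \<open>t\<close> and toggles
  \<open>h\<close>.\<close>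

lemma path_sum_eq:
  "path_sum h t fs x = 6 ^ length fs *
     (int x - (-1) ^ length fs * int t + (if odd (length fs) then int h else 0) + path_const fs)"
proof (induction fs arbitrary: x)
  case (Cons f fs)
  have choose: "3 choose 2 = (3::nat)" by (simp add: numeral_eq_Suc)
  show ?case
    unfolding path_sum.simps Cons.IH atLeastAtMost_1_4
    by (cases "even (length fs)") (simp_all add: choose algebra_simps)
qed simp

text \<open>\<open>x\<close> and \<open>t\<close> are the colors just before and just after the
  path, \<open>h\<close> is the hub color, and \<open>fs\<close> lists the pendant colors along
  it.\<close>

definition path_coloring :: "nat \<Rightarrow> nat \<Rightarrow> nat list \<Rightarrow> nat \<Rightarrow> nat list \<Rightarrow> bool" where
  "path_coloring h t fs x ys \<longleftrightarrow>
     list_all2 (\<lambda>y f. y \<in> {1..4} - {h, f}) ys fs \<and> successively (\<noteq>) (x # ys @ [t])"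

lemma path_coloring_Nil: "path_coloring h t [] x ys \<longleftrightarrow> ys = [] \<and> x \<noteq> t"
  by (auto simp: path_coloring_def)

lemma path_coloring_Cons:
  "path_coloring h t (f # fs) x ys \<longleftrightarrow>
     (\<exists>y zs. ys = y # zs \<and> y \<in> {1..4} - {h, f, x} \<and> path_coloring h t fs y zs)"
  by (auto simp: path_coloring_def list_all2_Cons2)

text \<open>A nonzero sum has a nonzero summand; its linear factors keep \<open>y\<close> away from
  \<open>x\<close>, \<open>f\<close>, \<open>h\<close>, and its last factor feeds the
  induction.\<close>

lemma path_coloring_exists:
  "path_sum h t fs x \<noteq> 0 \<Longrightarrow> \<exists>ys. path_coloring h t fs x ys"
proof (induction fs arbitrary: x)
  case (Cons f fs)
  then obtain y where y: "y \<in> {1..4}"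
    "(-1) ^ y * int (3 choose (y - 1)) * (int x - int y) * (int y - int f)
        * (int y - int h) * path_sum h t fs y \<noteq> 0"
    using sum.not_neutral_contains_not_neutral by (metis (lifting) path_sum.simps(2))
  with Cons.IH[of y] show ?case by (fastforce simp: path_coloring_Cons)
qed (auto simp: path_coloring_Nil)

text \<open>Uniqueness excludes cancellation: for every other first color a linear factor or, by
  \<open>path_coloring_exists\<close>, the remaining sum vanishes.\<close>

lemma path_sum_nonzero:
  "\<exists>!ys. path_coloring h t fs x ys \<Longrightarrow> path_sum h t fs x \<noteq> 0"
proof (induction fs arbitrary: x)
  case Nil
  then show ?case by (auto simp: path_coloring_Nil)
next
  case (Cons f fs)
  from Cons.prems obtain y zs where y: "y \<in> {1..4} - {h, f, x}" "path_coloring h t fs y zs"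
    by (auto simp: path_coloring_Cons)
  have uniq: "y' = y \<and> zs' = zs"
    if "y' \<in> {1..4} - {h, f, x}" "path_coloring h t fs y' zs'" for y' zs'
  proof -
    have "path_coloring h t (f # fs) x (y # zs)" "path_coloring h t (f # fs) x (y' # zs')"
      using y that by (auto simp: path_coloring_Cons)
    then show ?thesis using Cons.prems by blast
  qed
  let ?g = "\<lambda>y. (-1) ^ y * int (3 choose (y - 1)) * (int x - int y) * (int y - int f)
        * (int y - int h) * path_sum h t fs y"
  have "?g y' = 0" if "y' \<in> {1..4} - {y}" for y'
    using uniq[of y'] path_coloring_exists[of h t fs y'] that by fastforce
  then have "sum ?g {1..4} = ?g y"
    using y(1) by (subst sum.remove[of _ y]) (auto intro!: sum.neutral simp del: mult_eq_0_iff)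
  moreover have "path_sum h t fs y \<noteq> 0"
    using y uniq by (intro Cons.IH) blast
  ultimately show ?case
    using y(1) by auto
qed

text \<open>With equal end colors and even length the closed form is
  \<open>6 ^ length fs * path_const fs\<close>, so being nonzero carries over to all
  \<open>h'\<close> and \<open>t'\<close>.\<close>

lemma path_coloring_flexible:
  assumes "path_coloring h t fs t ys" "\<And>zs. path_coloring h t fs t zs \<Longrightarrow> zs = ys"
    and "even (length fs)"
  shows "\<exists>zs. path_coloring h' t' fs t' zs"
proof (rule path_coloring_exists)
  have "path_sum h t fs t \<noteq> 0"
    using assms(1,2) by (intro path_sum_nonzero) blast
  then show "path_sum h' t' fs t' \<noteq> 0"
    using assms(3) by (simp add: path_sum_eq)
qed

section \<open>Colorings of the corona of a wheel\<close>

abbreviation wheel_corona :: "nat \<Rightarrow> (nat option + nat option \<times> nat,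
    (nat option + nat option \<times> nat) \<times> (nat option + nat option \<times> nat)) pre_digraph" where
  "wheel_corona n \<equiv> with_proj (corona (wheel_graph n) (complete_graph 1))"

abbreviation wheel_verts :: "nat \<Rightarrow> nat option set" where
  "wheel_verts n \<equiv> insert None (Some ` {1..n})"

abbreviation pendants :: "nat \<Rightarrow> (nat option + nat option \<times> nat) set" where
  "pendants n \<equiv> (\<lambda>g. Inr (g, 1)) ` wheel_verts n"

text \<open>Stated with \<open>Suc 0\<close>, the form into which the simplifier turns
  \<open>1\<close>.\<close>

lemma pverts_wheel_corona:
  "pverts (corona (wheel_graph n) (complete_graph (Suc 0))) = Inl ` wheel_verts n \<union> pendants n"
  by (auto simp: corona_def wheel_graph_def cycle_graph_def complete_graph_def Let_def)

lemma proper_coloring_wheel_corona: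
  assumes "n \<ge> 3"
  shows "proper_coloring (wheel_corona n) k c \<longleftrightarrow>
     c \<in> extensional (verts (wheel_corona n)) \<and>
     (\<forall>g\<in>wheel_verts n. c (Inr (g, 1)) \<in> {1..k} \<and> c (Inl g) \<in> {1..k} - {c (Inr (g, 1))}) \<and>
     (\<forall>i\<in>{1..n}. c (Inl (Some i)) \<noteq> c (Inl None)) \<and>
     (\<forall>i\<in>{1..<n}. c (Inl (Some i)) \<noteq> c (Inl (Some (Suc i)))) \<and>
     c (Inl (Some n)) \<noteq> c (Inl (Some 1))"
proof -
  have arcs: "arcs (wheel_corona n) = (let
      A = (\<lambda>g. (Inl g, Inr (g, 1))) ` wheel_verts n \<union> (\<lambda>i. (Inl None, Inl (Some i))) ` {1..n} \<union>
          (\<lambda>i. (Inl (Some i), Inl (Some (Suc i)))) ` {1..<n} \<union> {(Inl (Some n), Inl (Some 1))}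
      in A \<union> A\<inverse>)"
    using assms
    by (auto simp: corona_def wheel_graph_def cycle_graph_def complete_graph_def Let_def)
  have "c \<in> verts (wheel_corona n) \<rightarrow>\<^sub>E {1..k} \<longleftrightarrow> c \<in> extensional (verts (wheel_corona n)) \<and>
      (\<forall>g\<in>wheel_verts n. c (Inl g) \<in> {1..k} \<and> c (Inr (g, 1)) \<in> {1..k})"
    by (simp add: PiE_iff pverts_wheel_corona ball_Un) blast
  moreover have "(\<forall>e\<in>arcs (wheel_corona n).
        c (tail (wheel_corona n) e) \<noteq> c (head (wheel_corona n) e)) \<longleftrightarrow>
      (\<forall>g\<in>wheel_verts n. c (Inl g) \<noteq> c (Inr (g, 1))) \<and>
      (\<forall>i\<in>{1..n}. c (Inl (Some i)) \<noteq> c (Inl None)) \<and>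
      (\<forall>i\<in>{1..<n}. c (Inl (Some i)) \<noteq> c (Inl (Some (Suc i)))) \<and>
      c (Inl (Some n)) \<noteq> c (Inl (Some 1))"
    unfolding arcs Let_def by (auto simp: ball_Un)
  ultimately show ?thesis
    unfolding proper_coloring_def Diff_iff singleton_iff ball_conj_distrib by argo
qed

text \<open>\<open>p g\<close> colors the pendant vertex at \<open>g\<close>;
  \<open>restrict\<close> makes the coloring extensional, as \<open>proper_coloring\<close>
  demands.\<close>

definition wheel_corona_coloring ::
    "nat \<Rightarrow> nat \<Rightarrow> (nat \<Rightarrow> nat) \<Rightarrow> (nat option \<Rightarrow> nat) \<Rightarrow> nat option + nat option \<times> nat \<Rightarrow> nat" where
  "wheel_corona_coloring n h r p =
     restrict (case_sum (case_option h r) (p \<circ> fst)) (verts (wheel_corona n))"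

lemma wheel_corona_coloring_simps:
  "wheel_corona_coloring n h r p (Inl None) = h"
  "i \<in> {1..n} \<Longrightarrow> wheel_corona_coloring n h r p (Inl (Some i)) = r i"
  "g \<in> wheel_verts n \<Longrightarrow> wheel_corona_coloring n h r p (Inr (g, 1)) = p g"
  by (auto simp: wheel_corona_coloring_def pverts_wheel_corona)

lemma proper_wheel_corona_coloring:
  assumes "n \<ge> 3"
  shows "proper_coloring (wheel_corona n) k (wheel_corona_coloring n h r p) \<longleftrightarrow>
     h \<in> {1..k} - {p None} \<and> (\<forall>i\<in>{1..n}. r i \<in> {1..k} - {h, p (Some i)}) \<and>
     (\<forall>g\<in>wheel_verts n. p g \<in> {1..k}) \<and> (\<forall>i\<in>{1..<n}. r i \<noteq> r (Suc i)) \<and> r n \<noteq> r 1"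
proof -
  have "wheel_corona_coloring n h r p \<in> extensional (verts (wheel_corona n))"
    by (simp add: wheel_corona_coloring_def)
  then show ?thesis
    unfolding proper_coloring_wheel_corona[OF assms]
    using assms
    by (auto simp: wheel_corona_coloring_simps wheel_corona_coloring_simps(3)[unfolded One_nat_def])
qed

lemma wheel_corona_coloring_eqI:
  assumes "c \<in> extensional (verts (wheel_corona n))"
    and "c (Inl None) = h" "\<And>i. i \<in> {1..n} \<Longrightarrow> c (Inl (Some i)) = r i"
    and "\<And>g. g \<in> wheel_verts n \<Longrightarrow> c (Inr (g, 1)) = p g"
  shows "c = wheel_corona_coloring n h r p"
proof (rule extensionalityI[OF assms(1)])
  show "c v = wheel_corona_coloring n h r p v" if "v \<in> verts (wheel_corona n)" for v
    using that assms(2-) by (auto simp: wheel_corona_coloring_def pverts_wheel_corona)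
qed (simp add: wheel_corona_coloring_def)

lemma proper_coloring_induce_subgraph:
  assumes "proper_coloring G k c" "S \<subseteq> verts G"
  shows "proper_coloring (G \<restriction> S) k (restrict c S)"
  using assms by (auto simp: proper_coloring_def PiE_iff induce_subgraph_def)

section \<open>The standard coloring and the chromatic number\<close>

definition rim_color :: "nat \<Rightarrow> nat \<Rightarrow> nat" where
  "rim_color n i = (if odd n \<and> i = n then 3 else if odd i then 1 else 2)"

text \<open>Pendant color 3 confines most rim vertices to 1 and 2. The exceptional rim pendant is
  the 2 at the first vertex for even \<open>n\<close>, which breaks the symmetry, and the 1 at the
  last vertex for odd \<open>n\<close>, where the rim color is 3.\<close>

definition pendant_color :: "nat \<Rightarrow> nat option \<Rightarrow> nat" where
  "pendant_color n g = (case g of None \<Rightarrow> 1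
     | Some i \<Rightarrow> if odd n \<and> i = n then 1 else if even n \<and> i = 1 then 2 else 3)"

abbreviation standard_coloring :: "nat \<Rightarrow> nat option + nat option \<times> nat \<Rightarrow> nat" where
  "standard_coloring n \<equiv>
     wheel_corona_coloring n (if even n then 3 else 4) (rim_color n) (pendant_color n)"

lemma proper_standard_coloring:
  assumes "n \<ge> 3"
  shows "proper_coloring (wheel_corona n) (if even n then 3 else 4) (standard_coloring n)"
  unfolding proper_wheel_corona_coloring[OF assms]
  using assms by (auto simp: rim_color_def pendant_color_def)

text \<open>The hub and two adjacent rim vertices form a triangle. With only three colors the rim
  would alternate between two, which fails on an odd cycle.\<close>

lemma chromatic_number_wheel_corona:
  assumes "n \<ge> 3"
  shows "chromatic_number (wheel_corona n) = (if even n then 3 else 4)"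
  unfolding chromatic_number_def
proof (rule Least_equality)
  show "\<exists>c. proper_coloring (wheel_corona n) (if even n then 3 else 4) c"
    using proper_standard_coloring[OF assms] by blast
next
  fix k assume "\<exists>c. proper_coloring (wheel_corona n) k c"
  then obtain c where c: "proper_coloring (wheel_corona n) k c" by blast
  define h r where "h = c (Inl None)" and "r i = c (Inl (Some i))" for i
  have range: "h \<in> {1..k}" "\<And>i. i \<in> {1..n} \<Longrightarrow> r i \<in> {1..k} - {h}"
    and edges: "\<And>i. i \<in> {1..<n} \<Longrightarrow> r i \<noteq> r (Suc i)" "r n \<noteq> r 1"
    using c assms unfolding proper_coloring_wheel_corona[OF assms] h_def r_def
    by auto
  have "card {h, r 1, r 2} \<le> card {1..k}"
    using range assms by (intro card_mono) auto
  moreover have "card {h, r 1, r 2} = 3"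
    using range(2)[of 1] range(2)[of 2] edges(1)[of 1] assms by (auto simp: numeral_2_eq_2)
  ultimately have "k \<ge> 3" by simp
  moreover have "k \<noteq> 3" if "odd n"
  proof
    assume "k = 3"
    have alt: "r (Suc (Suc i)) = r i" if "i \<in> {1..n - 2}" for i
    proof -
      have "i \<in> {1..<n}" "Suc i \<in> {1..<n}" "i \<in> {1..n}" "Suc i \<in> {1..n}" "Suc (Suc i) \<in> {1..n}"
        using that assms by auto
      then have "r i \<in> {1..3} - {h}" "r (Suc i) \<in> {1..3} - {h}" "r (Suc (Suc i)) \<in> {1..3} - {h}"
        "r i \<noteq> r (Suc i)" "r (Suc i) \<noteq> r (Suc (Suc i))" "h \<in> {1..3}"
        using range edges(1) \<open>k = 3\<close> by blast+
      moreover have "{1..3::nat} = {1, 2, 3}" by auto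
      ultimately show ?thesis by auto
    qed
    have "r (Suc (2 * m)) = r 1" if "Suc (2 * m) \<le> n" for m
      using that
    proof (induction m)
      case (Suc m)
      then show ?case using alt[of "Suc (2 * m)"] by simp
    qed simp
    with \<open>odd n\<close> edges(2) show False by (auto elim!: oddE)
  qed
  ultimately show "(if even n then 3 else 4) \<le> k"
    by (cases "even n") auto
qed

section \<open>Pendant vertices are always prescribed\<close>

lemma pendants_subset_sudoku:
  assumes "n \<ge> 3" "sudoku_coloring (wheel_corona n) S C0"
  shows "pendants n \<subseteq> S"
proof (rule ccontr)
  let ?k = "chromatic_number (wheel_corona n)"
  assume "\<not> ?thesis"
  then obtain g where g: "g \<in> wheel_verts n" "Inr (g, 1) \<notin> S" by blast
  obtain c where c: "extends_coloring (wheel_corona n) S C0 c"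
    and uniq: "\<And>c'. extends_coloring (wheel_corona n) S C0 c' \<Longrightarrow> c' = c"
    using assms(2) unfolding sudoku_coloring_def by blast
  have "card {c (Inl g), c (Inr (g, 1))} \<le> 2" by (simp add: card_insert_if)
  then have "\<not> {1..?k} \<subseteq> {c (Inl g), c (Inr (g, 1))}"
    using card_mono[of "{c (Inl g), c (Inr (g, 1))}" "{1..?k}"]
      chromatic_number_wheel_corona[OF assms(1)] by (auto split: if_splits)
  then obtain a where a: "a \<in> {1..?k}" "a \<noteq> c (Inl g)" "a \<noteq> c (Inr (g, 1))" by blast
  \<comment> \<open>The only neighbor of the pendant vertex is \<open>Inl g\<close>, so the
    recoloring stays proper.\<close>
  have "extends_coloring (wheel_corona n) S C0 (c(Inr (g, 1) := a))"
    using c a g assms(1)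
    unfolding extends_coloring_def proper_coloring_wheel_corona[OF assms(1)]
    by (auto simp: PiE_iff pverts_wheel_corona extensional_def)
  from uniq[OF this] a(3) show False by (metis fun_upd_same)
qed

section \<open>A Sudoku coloring of minimal size\<close>

lemma standard_coloring_unique:
  assumes n: "n \<ge> 3" and c: "proper_coloring (wheel_corona n) (if even n then 3 else 4) c"
    and pend: "\<And>g. g \<in> wheel_verts n \<Longrightarrow> c (Inr (g, 1)) = pendant_color n g"
    and fixed: "odd n \<Longrightarrow> c (Inl None) = 4" "odd n \<Longrightarrow> c (Inl (Some 1)) = 1"
  shows "c = standard_coloring n"
proof -
  define k :: nat where "k = (if even n then 3 else 4)"
  define h r where "h = c (Inl None)" and "r i = c (Inl (Some i))" for i
  have range: "h \<in> {1..k}" "\<And>i. i \<in> {1..n} \<Longrightarrow> r i \<in> {1..k} - {h, pendant_color n (Some i)}"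
    and edges: "\<And>i. i \<in> {1..<n} \<Longrightarrow> r i \<noteq> r (Suc i)" "r n \<noteq> r 1"
    using c n pend unfolding proper_coloring_wheel_corona[OF n] h_def r_def k_def
    by auto
  \<comment> \<open>Position 1 is left out because its pendant has color 2 for even
    \<open>n\<close>, position \<open>n\<close> because its pendant has color 1 for odd
    \<open>n\<close>.\<close>
  have no_3: "r i \<in> {1, 2}" if "i \<in> {2..<n}" for i
    using that range(2)[of i] fixed(1)
    by (auto simp: pendant_color_def h_def k_def split: if_splits)
  have last: "r n \<in> {1, 2}" if "even n"
    using that range(2)[of n] n by (auto simp: pendant_color_def k_def)
  have h: "h = k"
  proof (cases "even n")
    case True
    \<comment> \<open>Now 2 and 3 both lie in \<open>{2..<n}\<close>; these adjacent vertices use up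
      colors 1 and 2, leaving 3 for the hub.\<close>
    then have "n \<ge> 4" using n by presburger
    then show ?thesis
      using True no_3[of 2] no_3[of 3] range(1) range(2)[of 2] range(2)[of 3] edges(1)[of 2]
      by (auto simp: k_def numeral_3_eq_3 numeral_2_eq_2)
  qed (simp add: h_def k_def fixed)
  have first: "r 1 = 1"
  proof (cases "even n")
    case True
    then show ?thesis
      using range(2)[of 1] n h by (auto simp: k_def pendant_color_def)
  qed (simp add: r_def fixed(2)[simplified])
  have rim: "r i = (if odd i then 1 else 2)" if "1 \<le> i" "i < n \<or> even n \<and> i = n" for i
    using that
  proof (induction i rule: dec_induct)
    case (step i)
    then show ?case using edges(1)[of i] no_3[of "Suc i"] last by force
  qed (use first in simp)
  have "r n = rim_color n n"
  proof (cases "even n")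
    case True
    then show ?thesis using rim[of n] n by (simp add: rim_color_def)
  next
    case False
    \<comment> \<open>The last vertex thus loses 2 to its neighbor, 1 to its pendant and 4 to the
      hub, so 3 remains.\<close>
    then have "r (n - 1) = 2" using rim[of "n - 1"] n by simp
    then have "r n \<noteq> 2" using edges(1)[of "n - 1"] n by simp
    then show ?thesis
      using False range(2)[of n] n h
      by (auto simp: rim_color_def k_def pendant_color_def)
  qed
  then have "r i = rim_color n i" if "i \<in> {1..n}" for i
    using that rim[of i] by (cases "i = n") (auto simp: rim_color_def)
  then show ?thesis
    using c pend h unfolding proper_coloring_wheel_corona[OF n] h_def r_def k_def
    by (intro wheel_corona_coloring_eqI) auto
qed

lemma card_pendants: "card (pendants n) = n + 1"
proof -
  have "card (pendants n) = card (wheel_verts n)"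
    by (intro card_image inj_onI) simp
  also have "\<dots> = n + 1"
    by (simp add: card_image)
  finally show ?thesis .
qed

lemma sudoku_coloring_standard:
  assumes "n \<ge> 3"
  defines "S \<equiv> pendants n \<union> (if even n then {} else {Inl None, Inl (Some 1)})"
  shows "sudoku_coloring (wheel_corona n) S (restrict (standard_coloring n) S)"
    and "card S = (if even n then n + 1 else n + 3)"
proof -
  let ?c = "standard_coloring n"
  show "card S = (if even n then n + 1 else n + 3)"
    unfolding S_def using card_pendants[of n] by (auto simp: card_insert_if)
  have S: "S \<subseteq> verts (wheel_corona n)"
    using assms(1) by (auto simp: S_def pverts_wheel_corona)
  have "extends_coloring (wheel_corona n) S (restrict ?c S) ?c"
    using proper_standard_coloring[OF assms(1)] chromatic_number_wheel_corona[OF assms(1)]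
    by (simp add: extends_coloring_def)
  moreover have "c = ?c" if "extends_coloring (wheel_corona n) S (restrict ?c S) c" for c
  proof -
    have c: "proper_coloring (wheel_corona n) (if even n then 3 else 4) c"
      and eq: "\<And>v. v \<in> S \<Longrightarrow> c v = ?c v"
      using that chromatic_number_wheel_corona[OF assms(1)] by (auto simp: extends_coloring_def)
    show ?thesis
    proof (rule standard_coloring_unique[OF assms(1) c])
      show "c (Inr (g, 1)) = pendant_color n g" if "g \<in> wheel_verts n" for g
        using that eq[of "Inr (g, 1)"] wheel_corona_coloring_simps(3)[OF that]
        by (auto simp: S_def)
      show "c (Inl None) = 4" if "odd n"
        using that eq[of "Inl None"] by (simp add: S_def wheel_corona_coloring_simps)
      show "c (Inl (Some 1)) = 1" if "odd n"
        using that eq[of "Inl (Some 1)"] assms(1) wheel_corona_coloring_simps(2)[of 1 n]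
        by (auto simp: S_def rim_color_def)
    qed
  qed
  ultimately show "sudoku_coloring (wheel_corona n) S (restrict ?c S)"
    unfolding sudoku_coloring_def chromatic_number_wheel_corona[OF assms(1)]
    using proper_coloring_induce_subgraph[OF proper_standard_coloring[OF assms(1)] S] S
    by blast
qed

section \<open>Lower bound for odd wheels\<close>

text \<open>Rim vertices are renumbered by their distance from \<open>j\<close>, with \<open>j\<close> at both positions 0 and \<open>n\<close>.\<close>

definition rim_at :: "nat \<Rightarrow> nat \<Rightarrow> nat \<Rightarrow> nat" where
  "rim_at n j k = (if j + k \<le> n then j + k else j + k - n)"

text \<open>For \<open>j\<close> in \<open>{1..n}\<close>, the inverse of \<open>rim_at n j\<close>
  on the positions \<open>0..n - 1\<close>.\<close>

definition rim_index :: "nat \<Rightarrow> nat \<Rightarrow> nat \<Rightarrow> nat" where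
  "rim_index n j i = (if j \<le> i then i - j else n + i - j)"

abbreviation path_pendants :: "nat \<Rightarrow> nat \<Rightarrow> (nat option \<Rightarrow> nat) \<Rightarrow> nat list" where
  "path_pendants n j p \<equiv> map (\<lambda>k. p (Some (rim_at n j k))) [1..<n]"

text \<open>Cutting the rim at \<open>j\<close> leaves a path of \<open>n - 1\<close> vertices with
  \<open>j\<close> next to both ends, hence the end color \<open>r j\<close> twice.\<close>

lemma path_coloring_of_coloring:
  assumes "n \<ge> 3" "j \<in> {1..n}" "proper_coloring (wheel_corona n) 4 c"
  defines "r \<equiv> \<lambda>i. c (Inl (Some i))"
  shows "path_coloring (c (Inl None)) (r j) (path_pendants n j (\<lambda>g. c (Inr (g, 1)))) (r j)
           (map (\<lambda>k. r (rim_at n j k)) [1..<n])"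
proof -
  let ?ys = "map (\<lambda>k. r (rim_at n j k)) [1..<n]"
  have colors: "r i \<in> {1..4} - {c (Inl None), c (Inr (Some i, 1))}" if "i \<in> {1..n}" for i
    using assms(3) that unfolding proper_coloring_wheel_corona[OF assms(1)] r_def by auto
  have edges: "\<And>i. i \<in> {1..<n} \<Longrightarrow> r i \<noteq> r (Suc i)" "r n \<noteq> r 1"
    using assms(3) unfolding proper_coloring_wheel_corona[OF assms(1)] r_def by auto
  have "r j # ?ys @ [r j] = map (\<lambda>k. r (rim_at n j k)) [0..<Suc n]"
    using assms(1,2) by (simp add: upt_conv_Cons rim_at_def)
  moreover have "r (rim_at n j k) \<noteq> r (rim_at n j (Suc k))" if "k < n" for k
  \<comment> \<open>Here the step from \<open>k\<close> to \<open>Suc k\<close> crosses the edge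
    between rim vertices \<open>n\<close> and 1.\<close>
  proof (cases "j + k = n")
    case True
    then show ?thesis using edges(2) by (simp add: rim_at_def)
  next
    case False
    then have "rim_at n j k \<in> {1..<n}" "rim_at n j (Suc k) = Suc (rim_at n j k)"
      using that assms(2) by (auto simp: rim_at_def)
    then show ?thesis using edges(1) by simp
  qed
  ultimately have "successively (\<noteq>) (r j # ?ys @ [r j])"
    by (simp add: successively_conv_nth del: upt_Suc)
  moreover have "rim_at n j k \<in> {1..n}" if "k \<in> {1..<n}" for k
    using that assms(2) by (auto simp: rim_at_def)
  ultimately show ?thesis
    using colors by (simp add: path_coloring_def list_all2_conv_all_nth)
qed

text \<open>Closes the path up again. The last conclusion recovers \<open>ys\<close>, so uniqueness
  of the wheel coloring passes to the path coloring.\<close>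

lemma coloring_of_path_coloring:
  assumes n: "n \<ge> 3" and j: "j \<in> {1..n}"
    and h: "h \<in> {1..4} - {p None}" and t: "t \<in> {1..4} - {h, p (Some j)}"
    and p: "\<forall>g\<in>wheel_verts n. p g \<in> {1..4}"
    and path: "path_coloring h t (path_pendants n j p) t ys"
  defines "r \<equiv> \<lambda>i. (t # ys) ! rim_index n j i"
  shows "proper_coloring (wheel_corona n) 4 (wheel_corona_coloring n h r p)"
    and "r j = t" "map (\<lambda>k. r (rim_at n j k)) [1..<n] = ys"
proof -
  let ?zs = "t # ys @ [t]"
  have len: "length ys = n - 1"
    using path by (auto simp: path_coloring_def dest: list_all2_lengthD)
  have ys: "ys ! k \<in> {1..4} - {h, p (Some (rim_at n j (Suc k)))}" if "k < n - 1" for k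
    using path len that by (auto simp: path_coloring_def list_all2_conv_all_nth)
  have zs: "?zs ! k \<noteq> ?zs ! Suc k" if "k < n" for k
    using path len that n unfolding path_coloring_def successively_conv_nth by simp
  have index: "rim_index n j i < n" if "i \<in> {1..n}" for i
    using that j by (auto simp: rim_index_def)
  have r: "r i = ?zs ! rim_index n j i" if "i \<in> {1..n}" for i
    using index[OF that] len nth_append[of "t # ys" "[t]"] by (simp add: r_def)
  have last: "?zs ! n = t"
    using len n nth_append_length[of "t # ys" t "[]"] by simp
  show rj: "r j = t" by (simp add: r_def rim_index_def)
  have "r i \<in> {1..4} - {h, p (Some i)}" if i: "i \<in> {1..n}" for i
  proof (cases "i = j")
    case True
    then show ?thesis using rj t by simp
  next
    case False
    then obtain k where k: "rim_index n j i = Suc k"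
      using i j by (cases "rim_index n j i") (auto simp: rim_index_def split: if_splits)
    then have "k < n - 1" "rim_at n j (Suc k) = i"
      using i j index[OF i] by (auto simp: rim_index_def rim_at_def split: if_splits)
    then show ?thesis using ys[of k] k by (simp add: r_def)
  qed
  moreover have "r i \<noteq> r (Suc i)" if i: "i \<in> {1..<n}" for i
  proof -
    \<comment> \<open>If the successor is \<open>j\<close>, then \<open>r\<close> reads position 0
      while the list has reached position \<open>n\<close>; both hold \<open>t\<close>.\<close>
    have "r (Suc i) = ?zs ! Suc (rim_index n j i)"
    proof (cases "Suc i = j")
      case True
      then have "Suc (rim_index n j i) = n" using i by (auto simp: rim_index_def)
      then show ?thesis using rj last True by (simp del: nth_Cons_Suc)
    next
      case False
      then have "rim_index n j (Suc i) = Suc (rim_index n j i)"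
        using i j by (auto simp: rim_index_def)
      then show ?thesis using r[of "Suc i"] i by simp
    qed
    then show ?thesis using zs r[of i] index[of i] i by simp
  qed
  moreover have "r n \<noteq> r 1"
  proof -
    have "r 1 = ?zs ! Suc (rim_index n j n)"
    proof (cases "j = 1")
      case True
      then have "Suc (rim_index n j n) = n" using n by (simp add: rim_index_def)
      then show ?thesis using rj last True by (simp del: nth_Cons_Suc)
    next
      case False
      then have "rim_index n j 1 = Suc (rim_index n j n)"
        using j by (auto simp: rim_index_def)
      then show ?thesis using r[of 1] n by simp
    qed
    then show ?thesis using zs r[of n] index[of n] n by simp
  qed
  ultimately show "proper_coloring (wheel_corona n) 4 (wheel_corona_coloring n h r p)"
    unfolding proper_wheel_corona_coloring[OF n] using h p by blast
  show "map (\<lambda>k. r (rim_at n j k)) [1..<n] = ys"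
  proof (rule nth_equalityI)
    fix k assume "k < length (map (\<lambda>k. r (rim_at n j k)) [1..<n])"
    then have "k < n - 1" by simp
    then have "rim_index n j (rim_at n j (Suc k)) = Suc k"
      using j by (auto simp: rim_at_def rim_index_def)
    then show "map (\<lambda>k. r (rim_at n j k)) [1..<n] ! k = ys ! k"
      using \<open>k < n - 1\<close> by (simp add: r_def)
  qed (simp add: len)
qed

section \<open>One prescribed wheel vertex is not enough\<close>

lemma obtain_fourth_color:
  obtains a :: nat where "a \<in> {1..4}" "a \<notin> {x, y, z}"
proof -
  have "\<not> {1..4} \<subseteq> {x, y, z}"
    using card_mono[of "{x, y, z}" "{1..4}"] by (auto simp: card_insert_if split: if_splits)
  then show ?thesis using that by blast
qed

lemma sudoku_odd_wheel_verts:
  assumes n: "n \<ge> 3" "odd n" and S: "sudoku_coloring (wheel_corona n) S C0"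
  shows "card (S \<inter> Inl ` wheel_verts n) \<ge> 2"
proof (rule ccontr)
  assume "\<not> ?thesis"
  then have "card (S \<inter> Inl ` wheel_verts n) \<le> Suc 0" by simp
  moreover have "finite (S \<inter> Inl ` wheel_verts n)" by simp
  ultimately have eq: "\<forall>v \<in> S \<inter> Inl ` wheel_verts n. \<forall>w \<in> S \<inter> Inl ` wheel_verts n. v = w"
    by (simp only: card_le_Suc0_iff_eq)
  have "\<exists>g\<in>wheel_verts n. S \<inter> Inl ` wheel_verts n \<subseteq> {Inl g}"
  proof (cases "\<exists>g\<in>wheel_verts n. Inl g \<in> S")
    case True
    then obtain g where g: "g \<in> wheel_verts n" "Inl g \<in> S" by (elim bexE)
    then have "Inl g \<in> S \<inter> Inl ` wheel_verts n" by (intro IntI imageI)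
    then have "S \<inter> Inl ` wheel_verts n \<subseteq> {Inl g}"
      using eq by (intro subsetI) (simp only: singleton_iff)
    with g(1) show ?thesis by (rule bexI[rotated])
  next
    case False
    then have "S \<inter> Inl ` wheel_verts n = {}" by fast
    \<comment> \<open>With no wheel vertex in \<open>S\<close>, any \<open>g\<close> would
      do.\<close>
    then show ?thesis by (intro bexI[of _ None]) simp_all
  qed
  then obtain g where g: "g \<in> wheel_verts n" "S \<inter> Inl ` wheel_verts n \<subseteq> {Inl g}"
    by (elim bexE)
  \<comment> \<open>The cut is made at the prescribed rim vertex; if the hub is prescribed, the cut
    vertex is arbitrary.\<close>
  define j where "j = (case g of None \<Rightarrow> 1 | Some i \<Rightarrow> i)"
  have j: "j \<in> {1..n}" using g(1) n by (auto simp: j_def)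
  have chi: "chromatic_number (wheel_corona n) = 4"
    using chromatic_number_wheel_corona n by simp
  obtain c where c: "extends_coloring (wheel_corona n) S C0 c"
    and uniq: "\<And>c'. extends_coloring (wheel_corona n) S C0 c' \<Longrightarrow> c' = c"
    using S unfolding sudoku_coloring_def by blast
  have proper: "proper_coloring (wheel_corona n) 4 c"
    using c chi by (simp add: extends_coloring_def)
  define h r p where "h = c (Inl None)" and "r i = c (Inl (Some i))" and "p g = c (Inr (g, 1))"
    for i g
  define t fs where "t = r j" and "fs = path_pendants n j p"
  have h: "h \<in> {1..4} - {p None}" and t: "t \<in> {1..4} - {h, p (Some j)}"
    and p: "\<forall>g\<in>wheel_verts n. p g \<in> {1..4}"
    using proper j unfolding proper_coloring_wheel_corona[OF n(1)] h_def r_def p_def t_def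
    by auto
  \<comment> \<open>Any such data that keep the color of \<open>g\<close> glue to an extension of
    \<open>C0\<close>, which must be \<open>c\<close>.\<close>
  have rigid: "h' = h \<and> t' = t \<and> zs = map (\<lambda>k. r (rim_at n j k)) [1..<n]"
    if ht': "h' \<in> {1..4} - {p None}" "t' \<in> {1..4} - {h', p (Some j)}"
      and path: "path_coloring h' t' fs t' zs" and agree: "if g = None then h' = h else t' = t"
    for h' t' zs
  proof -
    define r' where "r' i = (t' # zs) ! rim_index n j i" for i
    define c' where "c' = wheel_corona_coloring n h' r' p"
    note r' = coloring_of_path_coloring[OF n(1) j ht' p path[unfolded fs_def],
        folded r'_def, folded c'_def]
    have c'_simps: "c' (Inl None) = h'" "\<And>i. i \<in> {1..n} \<Longrightarrow> c' (Inl (Some i)) = r' i"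
      "\<And>g. g \<in> wheel_verts n \<Longrightarrow> c' (Inr (g, 1)) = p g"
      unfolding c'_def by (intro wheel_corona_coloring_simps; assumption)+
    have "c' v = c v" if "v \<in> S" for v
    proof (cases v)
      case (Inl a)
      have "v \<in> verts (wheel_corona n)" using S that by (auto simp: sudoku_coloring_def)
      then have "a = g" using Inl that g(2) by (auto simp: pverts_wheel_corona)
      show ?thesis
      proof (cases g)
        case None
        then show ?thesis using Inl \<open>a = g\<close> agree c'_simps(1) by (simp add: h_def)
      next
        case (Some i)
        then have "i = j" by (simp add: j_def)
        then show ?thesis
          using Inl \<open>a = g\<close> agree Some c'_simps(2)[OF j] r'(2) by (simp add: t_def r_def)
      qed
    next
      case (Inr a)
      have "v \<in> verts (wheel_corona n)" using S that by (auto simp: sudoku_coloring_def)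
      then obtain b where "b \<in> wheel_verts n" "a = (b, 1)"
        using Inr by (auto simp: pverts_wheel_corona)
      then show ?thesis using Inr c'_simps(3)[of b] by (simp add: p_def)
    qed
    then have "extends_coloring (wheel_corona n) S C0 c'"
      using c r'(1) chi by (simp add: extends_coloring_def)
    then have "c' = c" by (rule uniq)
    then have "h' = h" and r_eq: "\<And>i. i \<in> {1..n} \<Longrightarrow> r' i = r i"
      using c'_simps by (auto simp: h_def r_def)
    moreover have "t' = t" using r_eq[OF j] r'(2) by (simp add: t_def)
    moreover have "rim_at n j k \<in> {1..n}" if "k \<in> {1..<n}" for k
      using that j by (auto simp: rim_at_def)
    then have "map (\<lambda>k. r (rim_at n j k)) [1..<n] = map (\<lambda>k. r' (rim_at n j k)) [1..<n]"
      using r_eq by (intro map_cong) auto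
    ultimately show ?thesis unfolding r'(3) by blast
  qed
  have flexible: "\<exists>zs. path_coloring h' t' fs t' zs" for h' t'
  proof (rule path_coloring_flexible)
    show "path_coloring h t fs t (map (\<lambda>k. r (rim_at n j k)) [1..<n])"
      using path_coloring_of_coloring[OF n(1) j proper]
      unfolding h_def t_def fs_def r_def p_def .
    show "zs = map (\<lambda>k. r (rim_at n j k)) [1..<n]" if "path_coloring h t fs t zs" for zs
      using rigid[OF h t that] by simp
    show "even (length fs)" using n by (simp add: fs_def)
  qed
  show False
  proof (cases "g = None")
    case True
    \<comment> \<open>With the hub color kept, the cut vertex has to avoid \<open>h\<close> and its
      pendant; avoiding \<open>t\<close> as well contradicts \<open>rigid\<close>.\<close>
    obtain t' where "t' \<in> {1..4}" "t' \<notin> {h, p (Some j), t}" by (rule obtain_fourth_color)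
    with rigid[of h t'] flexible[of h t'] h True show False by auto
  next
    case False
    \<comment> \<open>The hub must avoid only \<open>t\<close> and its own pendant here, since the
      rest of the rim is recolored by \<open>flexible\<close>.\<close>
    obtain h' where "h' \<in> {1..4}" "h' \<notin> {t, p None, h}" by (rule obtain_fourth_color)
    with rigid[of h' t] flexible[of h' t] t False show False by auto
  qed
qed

theorem theorem2p3:
  fixes n :: nat
  assumes "n \<ge> 3"
  shows "sudoku_number (with_proj (corona (wheel_graph n) (complete_graph 1))) =
           (if even n then n + 1 else n + 3)"
  unfolding sudoku_number_def
proof (rule Least_equality)
  show "\<exists>S C0. card S = (if even n then n + 1 else n + 3) \<and> sudoku_coloring (wheel_corona n) S C0"
    using sudoku_coloring_standard[OF assms] by blast
next
  fix m assume "\<exists>S C0. card S = m \<and> sudoku_coloring (wheel_corona n) S C0"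
  then obtain S C0 where S: "card S = m" "sudoku_coloring (wheel_corona n) S C0" by blast
  let ?T = "S \<inter> Inl ` wheel_verts n"
  have "S \<subseteq> verts (wheel_corona n)"
    using S(2) by (simp add: sudoku_coloring_def)
  then have fin: "finite S"
    by (rule finite_subset) (simp add: pverts_wheel_corona)
  \<comment> \<open>The pendants give \<open>n + 1\<close> for every \<open>n\<close>; the two extra
    vertices for odd \<open>n\<close> come from \<open>?T\<close>.\<close>
  have "card (pendants n \<union> ?T) = n + 1 + card ?T"
    using card_pendants[of n] by (subst card_Un_disjoint) auto
  moreover have "card (pendants n \<union> ?T) \<le> m"
    unfolding S(1)[symmetric]
    using pendants_subset_sudoku[OF assms S(2)] fin by (intro card_mono) auto
  ultimately show "(if even n then n + 1 else n + 3) \<le> m"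
    using sudoku_odd_wheel_verts[OF assms _ S(2)] by auto
qed

end
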